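(* Let $G$ be a marked group and let $T_G$ be its normal subgroup tree. Then $T_G$ is well-founded if and only if $G$ satisfies the maximal condition on normal subgroups.
   Context: Let $\mathbb{F}_\omega$ be the free group on countably many letters, with a fixed enumeration $(\gamma_i)_{i\in\mathbb{N}}$ of its elements. A marked group is $G=\mathbb{F}_\omega/N$ with $N\trianglelefteq\mathbb{F}_\omega$; it carries the enumeration $g_i:=\gamma_iN$, $i\in\mathbb{N}$ (repetitions allowed). For $s=(s_0,\dots,s_n)\in\mathbb{N}^{<\mathbb{N}}$ write $\{g_s\}=\{g_{s_0},\dots,g_{s_n}\}$, with $\{g_\emptyset\}=\emptyset$. $\langle\langle S\rangle\rangle$ denotes the normal closure of $S$ in $G$. $G$ satisfies the maximal condition on normal subgroups if there is no infinite strictly increasing chain of normal subgroups of $G$. The normal subgroup tree $T_G\subseteq\mathbb{N}^{<\mathbb{N}}$ is defined recursively, writing $(s,i)$ for the sequence $s$ extended by the term $i$: $\emptyset\in T_G$; and if $s\in T_G$ and $i\in\mathbb{N}$, then $(s,i)\in T_G$ if and only if $\langle\langle\{g_s\}\cup\{g_i\}\rangle\rangle\ne\langle\langle\{g_s\}\rangle\rangle$ (where $\langle\langle\emptyset\rangle\rangle=\{e\}$). A tree $T\subseteq\mathbb{N}^{<\mathbb{N}}$ (a set of finite sequences closed under initial segments) is well-founded if there is no $x\in\mathbb{N}^{\mathbb{N}}$ all of whose finite initial segments lie in $T$. *)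

theory Defs
  imports "HOL-Algebra.Algebra" "HOL-Library.Sublist"
begin

text \<open>Elements of the free group are the reduced words in the letters \<open>x\<^sub>0, x\<^sub>1, \<dots>\<close> and their formal inverses;
  \<open>(n, True)\<close> stands for \<open>x\<^sub>n\<close> and \<open>(n, False)\<close> for its inverse.\<close>

type_synonym letter = "nat \<times> bool"
type_synonym word = "letter list"

definition letter_inv :: "letter \<Rightarrow> letter" where
  "letter_inv a = (fst a, \<not> snd a)"

definition reduced :: "word \<Rightarrow> bool" where
  "reduced w \<longleftrightarrow> successively (\<lambda>a b. b \<noteq> letter_inv a) w"

text \<open>The product of reduced words \<open>u\<close> and \<open>v\<close> is \<open>foldr cancel_cons u v\<close>: the letters of \<open>u\<close>
  are put in front of \<open>v\<close> one by one, from the last to the first, with free cancellation.\<close>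

fun cancel_cons :: "letter \<Rightarrow> word \<Rightarrow> word" where
  "cancel_cons a [] = [a]"
| "cancel_cons a (b # w) = (if b = letter_inv a then w else a # b # w)"

definition free_group_omega :: "word monoid" where
  "free_group_omega = \<lparr>carrier = {w. reduced w}, monoid.mult = foldr cancel_cons, monoid.one = []\<rparr>"

lemma letter_inv_inv [simp]: "letter_inv (letter_inv a) = a"
  by (simp add: letter_inv_def)

lemma letter_inv_neq [simp]: "letter_inv a \<noteq> a" "a \<noteq> letter_inv a"
  by (simp_all add: letter_inv_def prod_eq_iff)

lemma reduced_Nil [simp]: "reduced []"
  by (simp add: reduced_def)

lemma reduced_Cons:
  "reduced (a # w) \<longleftrightarrow> reduced w \<and> (w \<noteq> [] \<longrightarrow> hd w \<noteq> letter_inv a)"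
  by (cases w) (auto simp: reduced_def)

lemma reduced_cancel_cons: "reduced w \<Longrightarrow> reduced (cancel_cons a w)"
  by (cases w) (auto simp: reduced_Cons)

lemma cancel_cons_inv: "reduced w \<Longrightarrow> cancel_cons a (cancel_cons (letter_inv a) w) = w"
  by (cases w; cases "tl w") (auto simp: reduced_Cons)

lemma reduced_foldr: "reduced v \<Longrightarrow> reduced (foldr cancel_cons u v)"
  by (induction u) (auto intro: reduced_cancel_cons)

lemma foldr_cancel_cons:
  assumes "reduced w"
  shows "foldr cancel_cons (cancel_cons a v) w = cancel_cons a (foldr cancel_cons v w)"
proof (cases v)
  case (Cons b v')
  then show ?thesis
    using cancel_cons_inv[OF reduced_foldr[OF assms, of v'], of a] by simp
qed simp

lemma foldr_foldr_cancel_cons: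
  "reduced w \<Longrightarrow>
    foldr cancel_cons (foldr cancel_cons u v) w = foldr cancel_cons u (foldr cancel_cons v w)"
  by (induction u) (simp_all add: foldr_cancel_cons)

lemma foldr_cancel_cons_Nil: "reduced u \<Longrightarrow> foldr cancel_cons u [] = u"
proof (induction u)
  case (Cons a u)
  then show ?case by (cases u) (auto simp: reduced_Cons)
qed simp

lemma foldr_left_inverse:
  assumes "reduced v"
  shows "foldr cancel_cons (rev (map letter_inv u)) (foldr cancel_cons u v) = v"
  using assms
proof (induction u arbitrary: v)
  case (Cons a u)
  then show ?case
    using cancel_cons_inv[OF reduced_foldr[OF Cons.prems, of u], of "letter_inv a"] by simp
qed simp

lemma group_free_group_omega: "group free_group_omega"
proof (rule groupI)
  fix u assume u: "u \<in> carrier free_group_omega"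
  define v where "v = foldr cancel_cons (rev (map letter_inv u)) []"
  have "reduced v" unfolding v_def by (simp add: reduced_foldr)
  moreover have "foldr cancel_cons v u = []"
  proof -
    have "foldr cancel_cons v u = foldr cancel_cons (rev (map letter_inv u)) u"
      using u foldr_foldr_cancel_cons[of u "rev (map letter_inv u)" "[]"]
      by (simp add: v_def free_group_omega_def)
    then show ?thesis
      using u foldr_left_inverse[of "[]" u]
      by (simp add: free_group_omega_def foldr_cancel_cons_Nil)
  qed
  ultimately show "\<exists>v\<in>carrier free_group_omega. v \<otimes>\<^bsub>free_group_omega\<^esub> u = \<one>\<^bsub>free_group_omega\<^esub>"
    by (auto simp: free_group_omega_def)
qed (auto simp: free_group_omega_def reduced_foldr foldr_foldr_cancel_cons)

lemma ex_enumeration_free_group_omega: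
  "\<exists>\<gamma> :: nat \<Rightarrow> word. range \<gamma> = carrier free_group_omega"
proof -
  have "carrier free_group_omega \<noteq> {}"
    by (auto simp: free_group_omega_def intro!: exI[of _ "[]"])
  then show ?thesis
    by (intro exI[of _ "from_nat_into (carrier free_group_omega)"] range_from_nat_into) auto
qed

text \<open>An enumeration of the free group is any \<open>\<gamma>\<close> with \<open>range \<gamma> = carrier free_group_omega\<close>; it
  need not be injective. As \<open>N\<close> is normal, the right coset below is the coset \<open>\<gamma>\<^sub>i N\<close>.\<close>

definition marked_group :: "word set \<Rightarrow> word set monoid" where
  "marked_group N = free_group_omega Mod N"

definition marked_enum :: "(nat \<Rightarrow> word) \<Rightarrow> word set \<Rightarrow> nat \<Rightarrow> word set" where
  "marked_enum \<gamma> N i = N #>\<^bsub>free_group_omega\<^esub> \<gamma> i"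

lemma group_marked_group: "N \<lhd> free_group_omega \<Longrightarrow> group (marked_group N)"
  unfolding marked_group_def by (rule normal.factorgroup_is_group)

lemma range_marked_enum:
  "range \<gamma> = carrier free_group_omega \<Longrightarrow> range (marked_enum \<gamma> N) = carrier (marked_group N)"
  by (force simp: marked_enum_def marked_group_def FactGroup_def RCOSETS_def)

definition normal_closure :: "('a, 'b) monoid_scheme \<Rightarrow> 'a set \<Rightarrow> 'a set" where
  "normal_closure G S = \<Inter> {H. H \<lhd> G \<and> S \<subseteq> H}"

definition max_condition_normal :: "('a, 'b) monoid_scheme \<Rightarrow> bool" where
  "max_condition_normal G \<longleftrightarrow>
    \<not> (\<exists>H :: nat \<Rightarrow> 'a set. (\<forall>n. H n \<lhd> G) \<and> (\<forall>n. H n \<subset> H (Suc n)))"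

definition is_tree :: "nat list set \<Rightarrow> bool" where
  "is_tree T \<longleftrightarrow> (\<forall>s\<in>T. \<forall>t. prefix t s \<longrightarrow> t \<in> T)"

definition well_founded_tree :: "nat list set \<Rightarrow> bool" where
  "well_founded_tree T \<longleftrightarrow> \<not> (\<exists>x :: nat \<Rightarrow> nat. \<forall>n. map x [0..<n] \<in> T)"

inductive_set normal_subgroup_tree ::
    "('a, 'b) monoid_scheme \<Rightarrow> (nat \<Rightarrow> 'a) \<Rightarrow> nat list set"
  for G :: "('a, 'b) monoid_scheme" and g :: "nat \<Rightarrow> 'a" where
  Nil: "[] \<in> normal_subgroup_tree G g"
| snoc: "\<lbrakk>s \<in> normal_subgroup_tree G g;
          normal_closure G (g ` set s \<union> {g i}) \<noteq> normal_closure G (g ` set s)\<rbrakk>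
         \<Longrightarrow> s @ [i] \<in> normal_subgroup_tree G g"

lemma snoc_in_normal_subgroup_tree_iff:
  "s \<in> normal_subgroup_tree G g \<Longrightarrow>
    s @ [i] \<in> normal_subgroup_tree G g \<longleftrightarrow>
      normal_closure G (g ` set s \<union> {g i}) \<noteq> normal_closure G (g ` set s)"
  by (auto elim: normal_subgroup_tree.cases intro: normal_subgroup_tree.snoc)

lemma is_tree_normal_subgroup_tree: "is_tree (normal_subgroup_tree G g)"
proof -
  have "\<forall>t. prefix t s \<longrightarrow> t \<in> normal_subgroup_tree G g"
    if "s \<in> normal_subgroup_tree G g" for s
    using that by induction (auto simp: prefix_snoc intro: normal_subgroup_tree.intros)
  then show ?thesis by (auto simp: is_tree_def)
qed

end

theory Submission
  imports Defs
begin

text \<open>Both conditions speak about strictly increasing sequences of normal subgroups. A sequence \<open>x\<close>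
  is a branch of the tree of \<open>G\<close> exactly when each \<open>g (x n)\<close> lies outside the normal closure of
  \<open>g (x 0), \<dots>, g (x (n - 1))\<close>. Along a branch these normal closures therefore
  form a strictly increasing chain (\<open>branch_gives_normal_chain\<close>). Conversely, a strictly increasing
  chain \<open>H\<close> yields a branch by choosing \<open>g (x n)\<close> in \<open>H (n + 1) - H n\<close>: the earlier choices all lie
  in \<open>H n\<close>, hence so does their normal closure, and \<open>g (x n)\<close> is new
  (\<open>normal_chain_gives_branch\<close>). The choice is possible because \<open>g\<close> runs through all elements of
  the group.\<close>

text \<open>This makes monotonicity and minimality of the normal closure, and the fact that a new
  generator enlarges it exactly when it was not yet a member, instances of facts about hulls.\<close>

lemma normal_closure_eq_hull: "normal_closure G S = (\<lambda>H. H \<lhd> G) hull S"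
  by (simp add: normal_closure_def hull_def)

text \<open>The family of normal subgroups containing \<open>S\<close> has the whole group as a member, so its
  intersection is not the degenerate \<open>\<Inter> {} = UNIV\<close>.\<close>

lemma (in group) normal_normal_closure:
  assumes "S \<subseteq> carrier G"
  shows "normal_closure G S \<lhd> G"
proof -
  have carrier: "carrier G \<in> {H. H \<lhd> G \<and> S \<subseteq> H}"
    using assms by (auto simp: normal_inv_iff subgroup_self)
  have "subgroup (normal_closure G S) G"
    unfolding normal_closure_def
    using carrier by (intro subgroups_Inter) (auto simp: normal_inv_iff)
  then show ?thesis
    by (auto simp: normal_inv_iff normal_closure_def)
qed

text \<open>The tree records when a generator changes the normal closure; both chain constructions
  need membership instead, and for hulls the two agree.\<close>

lemma branch_iff_not_in_normal_closure:
  "(\<forall>n. map x [0..<n] \<in> normal_subgroup_tree G g) \<longleftrightarrow>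
    (\<forall>n. g (x n) \<notin> normal_closure G (g ` x ` {..<n}))"
proof -
  have step: "map x [0..<Suc n] \<in> normal_subgroup_tree G g \<longleftrightarrow>
      g (x n) \<notin> normal_closure G (g ` x ` {..<n})"
    if "map x [0..<n] \<in> normal_subgroup_tree G g" for n
    using snoc_in_normal_subgroup_tree_iff[OF that, of "x n"]
    by (simp add: normal_closure_eq_hull hull_redundant_eq atLeast0LessThan)
  show ?thesis
  proof (intro iffI allI)
    fix n
    assume "\<forall>n. map x [0..<n] \<in> normal_subgroup_tree G g"
    then show "g (x n) \<notin> normal_closure G (g ` x ` {..<n})"
      using step by blast
  next
    fix n
    assume "\<forall>n. g (x n) \<notin> normal_closure G (g ` x ` {..<n})"
    then show "map x [0..<n] \<in> normal_subgroup_tree G g"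
    proof (induction n)
      case 0
      show ?case by (simp add: normal_subgroup_tree.Nil)
    next
      case (Suc n)
      then show ?case using step by blast
    qed
  qed
qed

lemma (in group) branch_gives_normal_chain:
  assumes g: "range g \<subseteq> carrier G"
    and branch: "\<And>n. map x [0..<n] \<in> normal_subgroup_tree G g"
  shows "\<exists>H :: nat \<Rightarrow> 'a set. (\<forall>n. H n \<lhd> G) \<and> (\<forall>n. H n \<subset> H (Suc n))"
proof -
  define H where "H n = normal_closure G (g ` x ` {..<n})" for n
  have "H n \<subset> H (Suc n)" for n
  proof
    show "H n \<subseteq> H (Suc n)"
      unfolding H_def normal_closure_eq_hull by (intro hull_mono image_mono) auto
    have "g (x n) \<in> H (Suc n)"
      unfolding H_def normal_closure_eq_hull by (intro hull_inc) auto
    moreover have "g (x n) \<notin> H n"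
      using branch branch_iff_not_in_normal_closure unfolding H_def by blast
    ultimately show "H n \<noteq> H (Suc n)" by blast
  qed
  moreover have "H n \<lhd> G" for n
    unfolding H_def using g by (intro normal_normal_closure) auto
  ultimately show ?thesis by blast
qed

lemma (in group) normal_chain_gives_branch:
  assumes g: "carrier G \<subseteq> range g"
    and normal: "\<And>n. H n \<lhd> G" and less: "\<And>n. H n \<subset> H (Suc n)"
  shows "\<exists>x. \<forall>n. map x [0..<n] \<in> normal_subgroup_tree G g"
proof -
  have "\<exists>i. g i \<in> H (Suc n) - H n" for n
  proof -
    obtain a where a: "a \<in> H (Suc n) - H n"
      using less by blast
    then have "a \<in> carrier G"
      using normal[of "Suc n"] by (auto simp: normal_inv_iff dest: subgroup.mem_carrier)
    then show ?thesis using g a by blast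
  qed
  then obtain x where x: "g (x n) \<in> H (Suc n) - H n" for n
    by metis
  have "g (x n) \<notin> normal_closure G (g ` x ` {..<n})" for n
  proof -
    have "g (x m) \<in> H n" if "m < n" for m
      using x[of m] lift_Suc_mono_le[of H "Suc m" n] less that by (auto simp: less_imp_le)
    then have "normal_closure G (g ` x ` {..<n}) \<subseteq> H n"
      unfolding normal_closure_eq_hull using normal by (intro hull_minimal) auto
    then show ?thesis using x by blast
  qed
  then show ?thesis using branch_iff_not_in_normal_closure by blast
qed

theorem lemma5p3:
  fixes \<gamma> :: "nat \<Rightarrow> word" and N :: "word set"
  assumes "range \<gamma> = carrier free_group_omega"
    and "N \<lhd> free_group_omega"
  shows "well_founded_tree (normal_subgroup_tree (marked_group N) (marked_enum \<gamma> N))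
    \<longleftrightarrow> max_condition_normal (marked_group N)"
proof -
  interpret G: group "marked_group N"
    using assms(2) by (rule group_marked_group)
  have enum: "range (marked_enum \<gamma> N) = carrier (marked_group N)"
    using assms(1) by (rule range_marked_enum)
  show ?thesis
    unfolding well_founded_tree_def max_condition_normal_def
    using G.branch_gives_normal_chain[of "marked_enum \<gamma> N"]
      G.normal_chain_gives_branch[of "marked_enum \<gamma> N"] enum
    by (metis order_refl)
qed

end
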